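(* Let $\mathbf{P}$ be a quadrilateral inscribed in the unit circle, with hyperbolic barycenter $S_{\mathbf{P}}$ and least-squares point $L_{\mathbf{P}}$. Then $S_{\mathbf{P}}=L_{\mathbf{P}}$ if and only if $\mathbf{P}$ is harmonic or $S_{\mathbf{P}}=(0,0)$.
   Context: The unit circle $\mathbf{O}$ is identified with $\mathbb{RP}^1=\mathbb{R}\cup\{\infty\}$ by $p\mapsto P=\left(\frac{1-p^2}{1+p^2},\frac{2p}{1+p^2}\right)$, $\infty\mapsto(-1,0)$; the open unit disc is the Klein–Beltrami model of the hyperbolic plane, in which geodesics are open chords. A quadrilateral $\mathbf{P}=(p_1,\dots,p_4)$ inscribed in $\mathbf{O}$ has vertices the points $P_\ell$ corresponding to pairwise distinct $p_\ell$, and sides $\xi_\ell=P_\ell P_{\ell+1}$ (indices modulo $4$); it is regarded both as an inscribed Euclidean quadrilateral and as an ideal hyperbolic quadrilateral. It is harmonic if it is the image of a regular quadrilateral (a square) inscribed in $\mathbf{O}$ under an isometry of the hyperbolic plane (equivalently, under a projective transformation preserving $\mathbf{O}$). The hyperbolic barycenter is $$S_{\mathbf{P}}=\left(\frac{I-K}{I+K},\frac{2J}{I+K}\right),\quad I=\sum_{\ell}\frac{1}{p_\ell-p_{\ell+1}},\ J=\frac12\sum_{\ell}\frac{p_\ell+p_{\ell+1}}{p_\ell-p_{\ell+1}},\ K=\sum_{\ell}\frac{p_\ell p_{\ell+1}}{p_\ell-p_{\ell+1}},$$ where, if one of the $p_\ell$ is $\infty$, each summand is replaced by its limit (the formula makes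 sense when $I+K\ne0$, which holds generically, and always when $\mathbf{P}$ is convex). The least-squares point $L_{\mathbf{P}}$ is the unique point minimizing $\sum_\ell d_\ell(X)^2$, where $d_\ell(X)$ is the Euclidean distance from $X$ to the line through $P_\ell$ and $P_{\ell+1}$. *)

theory Defs
  imports "HOL-Analysis.Analysis" "HOL-Real_Asymp.Real_Asymp"
begin

datatype rp1 = Fin real | Infty

fun circle_point :: "rp1 \<Rightarrow> real \<times> real" where
  "circle_point (Fin p) = ((1 - p\<^sup>2) / (1 + p\<^sup>2), 2 * p / (1 + p\<^sup>2))"
| "circle_point Infty = (-1, 0)"

text \<open>
  A quadrilateral is an injective function on the numeral type \<open>4\<close>, on which \<open>l + 1\<close> wraps around
  modulo 4.
\<close>

definition inscribed_quadrilateral :: "(4 \<Rightarrow> rp1) \<Rightarrow> bool" where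
  "inscribed_quadrilateral p \<longleftrightarrow> inj p"

definition vertex :: "(4 \<Rightarrow> rp1) \<Rightarrow> 4 \<Rightarrow> real \<times> real" where
  "vertex p l = circle_point (p l)"


subsection \<open>Hyperbolic barycenter\<close>

text \<open>
  The equations involving \<^const>\<open>Infty\<close> are the limits of the finite ones, see
  \<open>tendsto_terms_Infty\<close> below. The value at two points at infinity is irrelevant, since the vertices
  of a quadrilateral are pairwise distinct.
\<close>

fun termI :: "rp1 \<Rightarrow> rp1 \<Rightarrow> real" where
  "termI (Fin p) (Fin q) = 1 / (p - q)"
| "termI Infty (Fin q) = 0"
| "termI (Fin p) Infty = 0"
| "termI Infty Infty = 0"

fun termJ :: "rp1 \<Rightarrow> rp1 \<Rightarrow> real" where
  "termJ (Fin p) (Fin q) = (p + q) / (p - q)"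
| "termJ Infty (Fin q) = 1"
| "termJ (Fin p) Infty = -1"
| "termJ Infty Infty = 0"

fun termK :: "rp1 \<Rightarrow> rp1 \<Rightarrow> real" where
  "termK (Fin p) (Fin q) = p * q / (p - q)"
| "termK Infty (Fin q) = q"
| "termK (Fin p) Infty = -p"
| "termK Infty Infty = 0"

lemma tendsto_terms_Infty:
  "((\<lambda>p. termI (Fin p) (Fin q)) \<longlongrightarrow> termI Infty (Fin q)) at_infinity"
  "((\<lambda>p. termI (Fin q) (Fin p)) \<longlongrightarrow> termI (Fin q) Infty) at_infinity"
  "((\<lambda>p. termJ (Fin p) (Fin q)) \<longlongrightarrow> termJ Infty (Fin q)) at_infinity"
  "((\<lambda>p. termJ (Fin q) (Fin p)) \<longlongrightarrow> termJ (Fin q) Infty) at_infinity"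
  "((\<lambda>p. termK (Fin p) (Fin q)) \<longlongrightarrow> termK Infty (Fin q)) at_infinity"
  "((\<lambda>p. termK (Fin q) (Fin p)) \<longlongrightarrow> termK (Fin q) Infty) at_infinity"
  unfolding at_infinity_eq_at_top_bot termI.simps termJ.simps termK.simps
  by (intro filterlim_sup; real_asymp)+

definition sumI :: "(4 \<Rightarrow> rp1) \<Rightarrow> real" where
  "sumI p = (\<Sum>l\<in>UNIV. termI (p l) (p (l + 1)))"

definition sumJ :: "(4 \<Rightarrow> rp1) \<Rightarrow> real" where
  "sumJ p = 1 / 2 * (\<Sum>l\<in>UNIV. termJ (p l) (p (l + 1)))"

definition sumK :: "(4 \<Rightarrow> rp1) \<Rightarrow> real" where
  "sumK p = (\<Sum>l\<in>UNIV. termK (p l) (p (l + 1)))"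

text \<open>Meaningful only if \<open>sumI p + sumK p \<noteq> 0\<close>.\<close>

definition hyperbolic_barycenter :: "(4 \<Rightarrow> rp1) \<Rightarrow> real \<times> real" where
  "hyperbolic_barycenter p =
    ((sumI p - sumK p) / (sumI p + sumK p), 2 * sumJ p / (sumI p + sumK p))"


subsection \<open>Least-squares point\<close>

definition side_dist :: "(4 \<Rightarrow> rp1) \<Rightarrow> 4 \<Rightarrow> real \<times> real \<Rightarrow> real" where
  "side_dist p l X = infdist X (affine hull {vertex p l, vertex p (l + 1)})"

definition least_squares_point :: "(4 \<Rightarrow> rp1) \<Rightarrow> real \<times> real" where
  "least_squares_point p =
    (THE X. \<forall>Y. (\<Sum>l\<in>UNIV. (side_dist p l X)\<^sup>2) \<le> (\<Sum>l\<in>UNIV. (side_dist p l Y)\<^sup>2))"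


subsection \<open>Harmonic quadrilaterals\<close>

text \<open>The distance of the Klein--Beltrami model, on the open unit disc \<open>ball 0 1\<close>.\<close>

definition klein_dist :: "real \<times> real \<Rightarrow> real \<times> real \<Rightarrow> real" where
  "klein_dist X Y = arcosh ((1 - X \<bullet> Y) / sqrt ((1 - X \<bullet> X) * (1 - Y \<bullet> Y)))"

definition hyperbolic_isometry :: "(real \<times> real \<Rightarrow> real \<times> real) \<Rightarrow> bool" where
  "hyperbolic_isometry f \<longleftrightarrow>
    f ` ball 0 1 = ball 0 1 \<and>
    (\<forall>X\<in>ball 0 1. \<forall>Y\<in>ball 0 1. klein_dist (f X) (f Y) = klein_dist X Y)"

definition inscribed_square :: "(4 \<Rightarrow> real \<times> real) \<Rightarrow> bool" where
  "inscribed_square Q \<longleftrightarrow>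
    inj Q \<and> (\<forall>l. Q l \<in> sphere 0 1) \<and>
    (\<forall>l. dist (Q l) (Q (l + 1)) = dist (Q (l + 1)) (Q (l + 2))) \<and>
    (\<forall>l. (Q l - Q (l + 1)) \<bullet> (Q (l + 2) - Q (l + 1)) = 0)"

text \<open>
  An isometry acts on ideal points, that is on the unit circle, through its continuous extension to
  the closed disc; hence the limit.
\<close>

definition harmonic :: "(4 \<Rightarrow> rp1) \<Rightarrow> bool" where
  "harmonic p \<longleftrightarrow>
    (\<exists>f Q. hyperbolic_isometry f \<and> inscribed_square Q \<and>
      (\<forall>l. (f \<longlongrightarrow> vertex p l) (at (Q l) within ball 0 1)))"

end

theory Submission
  imports Defs
begin

text \<open>
  Write the vertices as complex numbers \<open>z0, z1, z2, z3\<close> of modulus 1. The line through two points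
  \<open>z\<close> and \<open>w\<close> of the unit circle is \<open>x + z * w * cnj x = z + w\<close>, and the distance of \<open>x\<close> to it is
  half the modulus of the difference of the two sides.

  The hyperbolic barycenter \<open>S\<close> is the intersection of the diagonals (\<open>barycenter_on_diagonals\<close>,
  \<open>diagonal_meet\<close>), convex or not, so it satisfies the two equations
  \<open>S + z0 * z2 * cnj S = z0 + z2\<close> and \<open>S + z1 * z3 * cnj S = z1 + z3\<close>. The
  least-squares point is the only solution of the sum of the four side equations, which is
  \<open>4 * x + (z0 + z2) * (z1 + z3) * cnj x = 2 * (z0 + z1 + z2 + z3)\<close>
  (\<open>least_squares_point_iff\<close>). Subtracting twice the sum of the diagonal equations shows that \<open>S\<close>
  solves it if and only if \<open>S = 0\<close> or \<open>(z0 + z2) * (z1 + z3) = 2 * (z0 * z2 + z1 * z3)\<close>. The latter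
  says \<open>(z0 - z1) * (z2 - z3) = (z0 - z3) * (z1 - z2)\<close>, that is, the vertices have
  cross ratio \<open>- 1\<close>.

  It remains to identify this condition with being the isometric image of a square. An isometry of
  the Klein model preserves the quotients \<open>(1 - A \<bullet> B) * (1 - C \<bullet> D) / ((1 - A \<bullet> C) * (1 - B \<bullet> D))\<close>.
  On the circle, where \<open>1 - A \<bullet> B\<close> is half the square of a chord length, they
  become squared moduli of cross ratios, and these determine the cross ratio in the case of a square
  (\<open>harmonicD\<close>). Conversely, a quadrilateral with cross ratio \<open>- 1\<close> is the image of a square under
  an explicit projective map of the disc (\<open>harmonicI\<close>).
\<close>

section \<open>The index type and complex coordinates\<close>

lemma UNIV_4_eq: "(UNIV :: 4 set) = {0, 1, 2, 3}"
  using UNIV_4 by auto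

lemma wrap_4: "(4 :: 4) = 0" "(5 :: 4) = 1"
  by simp_all

lemma sum_over_4: "sum f (UNIV :: 4 set) = f 0 + f 1 + f 2 + (f 3 :: 'a :: comm_monoid_add)"
  unfolding UNIV_4_eq by (simp add: add.assoc)

lemma all_4_iff: "(\<forall>l::4. P l) \<longleftrightarrow> P 0 \<and> P 1 \<and> P 2 \<and> P 3"
  using UNIV_4_eq by (metis UNIV_I empty_iff insert_iff)

definition cpx :: "real \<times> real \<Rightarrow> complex" where
  "cpx X = Complex (fst X) (snd X)"

lemma cpx_eq_iff [simp]: "cpx X = cpx Y \<longleftrightarrow> X = Y"
  by (simp add: cpx_def prod_eq_iff)

lemma cpx_origin [simp]: "cpx (0, 0) = 0"
  by (simp add: cpx_def complex_eq_iff)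

lemma cpx_Re_Im [simp]: "cpx (Re w, Im w) = w"
  by (simp add: cpx_def)

lemma inner_cpx: "X \<bullet> Y = Re (cpx X * cnj (cpx Y))"
  by (simp add: cpx_def inner_prod_def)

lemma cmod_cpx: "cmod (cpx X) = norm X"
  by (simp add: cpx_def norm_prod_def cmod_def)

lemma dist_cpx: "dist X Y = cmod (cpx X - cpx Y)"
  by (simp add: cpx_def dist_norm norm_prod_def cmod_def)

lemma unit_mult_cnj:
  assumes "cmod z = 1"
  shows "z * cnj z = 1"
  using complex_norm_square[of z] assms by simp

lemma i_denominator_nonzero: "1 - \<i> * of_real x \<noteq> 0" "1 + \<i> * of_real x \<noteq> 0"
  by (simp_all add: complex_eq_iff)

lemma circle_point_Fin_cpx:
  "cpx (circle_point (Fin x)) = (1 + \<i> * of_real x) / (1 - \<i> * of_real x)"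
proof -
  have "1 + x\<^sup>2 \<noteq> 0"
    using zero_le_power2[of x] by linarith
  then have "cpx (circle_point (Fin x)) * (1 - \<i> * of_real x) = 1 + \<i> * of_real x"
    by (simp add: cpx_def complex_eq_iff divide_simps) (simp add: power2_eq_square algebra_simps)
  then show ?thesis
    using i_denominator_nonzero[of x] by (simp only: nonzero_eq_divide_eq not_False_eq_True)
qed

lemma circle_point_Infty_cpx: "cpx (circle_point Infty) = -1"
  by (simp add: cpx_def complex_eq_iff)

lemma cmod_circle_point: "cmod (cpx (circle_point a)) = 1"
proof (cases a)
  case (Fin x)
  have "cmod (1 + \<i> * of_real x) = cmod (1 - \<i> * of_real x)"
    by (simp add: cmod_def)
  then show ?thesis
    unfolding Fin circle_point_Fin_cpx
    using i_denominator_nonzero[of x] by (simp add: norm_divide)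
next
  case Infty
  then show ?thesis by (simp add: circle_point_Infty_cpx del: circle_point.simps)
qed

lemma circle_point_inj:
  assumes "circle_point a = circle_point b"
  shows "a = b"
proof -
  have neq: "(1 + \<i> * of_real x) / (1 - \<i> * of_real x) \<noteq> -1" for x
    using i_denominator_nonzero[of x] by (subst nonzero_divide_eq_eq) (simp_all add: complex_eq_iff)
  have "x = y" if "(1 + \<i> * of_real x) / (1 - \<i> * of_real x)
      = (1 + \<i> * of_real y) / (1 - \<i> * of_real y)" for x y
    using that i_denominator_nonzero[of x] i_denominator_nonzero[of y]
    by (simp add: frac_eq_eq) (simp add: complex_eq_iff algebra_simps)
  moreover have "cpx (circle_point a) = cpx (circle_point b)"
    using assms by simp
  ultimately show ?thesis
    using neq neq[symmetric]
    by (cases a; cases b)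
       (simp_all add: circle_point_Fin_cpx circle_point_Infty_cpx del: circle_point.simps cpx_eq_iff)
qed

definition zvertex :: "(4 \<Rightarrow> rp1) \<Rightarrow> 4 \<Rightarrow> complex" where
  "zvertex p l = cpx (vertex p l)"

lemma zvertex_facts:
  shows "cmod (zvertex p l) = 1"
    and "inscribed_quadrilateral p \<Longrightarrow> zvertex p k = zvertex p l \<longleftrightarrow> k = l"
  by (auto simp: zvertex_def vertex_def cmod_circle_point inscribed_quadrilateral_def
      dest: circle_point_inj injD)

section \<open>The hyperbolic barycenter\<close>

text \<open>
  Two points on the unit circle determine the pole of their chord, which in homogeneous coordinates
  is \<open>(z + w : 2zw)\<close>. The three summands of the barycenter are the real coordinates of this
  pole, multiplied by \<open>\<i> / (z - w)\<close>; the point at infinity stops being exceptional in these coordinates.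
\<close>

lemma barycenter_terms_cpx:
  assumes "a \<noteq> b"
  defines "z \<equiv> cpx (circle_point a)" and "w \<equiv> cpx (circle_point b)"
  shows "complex_of_real (termI a b + termK a b) = \<i> * ((z + w) / (z - w))"
    and "Complex (termI a b - termK a b) (termJ a b) = 2 * \<i> * (z * w / (z - w))"
proof -
  have zw: "z - w \<noteq> 0"
    using assms circle_point_inj by auto
  have "complex_of_real (termI a b + termK a b) * (z - w) = \<i> * (z + w) \<and>
      Complex (termI a b - termK a b) (termJ a b) * (z - w) = 2 * \<i> * (z * w)"
  proof (cases a)
    case (Fin x)
    note [simp] = i_denominator_nonzero
    show ?thesis
    proof (cases b)
      case F: (Fin y)
      have xy: "x - y \<noteq> 0" using assms Fin F by simp
      have J: "Complex (termI a b - termK a b) (termJ a b)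
          = (1 - of_real x * of_real y + \<i> * (of_real x + of_real y)) / of_real (x - y)"
        using xy by (simp add: Fin F complex_eq_iff diff_divide_distrib add_divide_distrib)
      have I: "complex_of_real (termI a b + termK a b) = (1 + of_real x * of_real y) / of_real (x - y)"
        by (simp add: Fin F add_divide_distrib)
      have xy': "complex_of_real x - of_real y \<noteq> 0"
        using xy by (metis of_real_diff of_real_eq_0_iff)
      have d: "z - w = 2 * \<i> * (of_real x - of_real y) / ((1 - \<i> * of_real x) * (1 - \<i> * of_real y))"
        unfolding z_def w_def Fin F circle_point_Fin_cpx
        by (simp add: divide_simps) (simp add: algebra_simps)
      have s: "z + w = 2 * (1 + of_real x * of_real y) / ((1 - \<i> * of_real x) * (1 - \<i> * of_real y))"
        unfolding z_def w_def Fin F circle_point_Fin_cpx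
        by (simp add: divide_simps) (simp add: algebra_simps)
      have q: "1 - of_real x * of_real y + \<i> * (of_real x + of_real y)
          = (1 + \<i> * of_real x) * (1 + \<i> * of_real y)"
        by (simp add: algebra_simps)
      show ?thesis
        unfolding I J q d s using xy' 
        unfolding z_def w_def Fin F circle_point_Fin_cpx
        by (simp add: divide_simps)
    next
      case Infty
      show ?thesis
        unfolding z_def w_def Fin Infty circle_point_Fin_cpx circle_point_Infty_cpx
        by (simp add: divide_simps Complex_eq) (simp add: algebra_simps)
    qed
  next
    case Infty
    note [simp] = i_denominator_nonzero
    show ?thesis
    proof (cases b)
      case (Fin y)
      show ?thesis
        unfolding z_def w_def Fin Infty circle_point_Fin_cpx circle_point_Infty_cpx
        by (simp add: divide_simps Complex_eq) (simp add: algebra_simps)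
    qed (use assms Infty in simp)
  qed
  then show "complex_of_real (termI a b + termK a b) = \<i> * ((z + w) / (z - w))"
    and "Complex (termI a b - termK a b) (termJ a b) = 2 * \<i> * (z * w / (z - w))"
    using zw by (auto simp: eq_divide_eq)
qed

text \<open>
  Both sums are cyclic and change sign under reflection of the order, and they vanish when two
  opposite vertices coincide; hence the common factor \<open>(z0 - z2) * (z1 - z3)\<close>, which leaves only
  a quotient of low degree.
\<close>

lemma cyclic_sums:
  fixes z0 z1 z2 z3 :: complex
  assumes "z0 \<noteq> z1" "z1 \<noteq> z2" "z2 \<noteq> z3" "z3 \<noteq> z0"
  defines "D \<equiv> (z0 - z2) * (z1 - z3) / ((z0 - z1) * (z1 - z2) * (z2 - z3) * (z3 - z0))"
  shows "(z0 + z1) / (z0 - z1) + (z1 + z2) / (z1 - z2) + (z2 + z3) / (z2 - z3) + (z3 + z0) / (z3 - z0)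
      = 2 * D * (z1 * z3 - z0 * z2)"
    and "z0 * z1 / (z0 - z1) + z1 * z2 / (z1 - z2) + z2 * z3 / (z2 - z3) + z3 * z0 / (z3 - z0)
      = D * (z1 * z3 * (z0 + z2) - z0 * z2 * (z1 + z3))"
proof -
  have nz: "z0 - z1 \<noteq> 0" "z1 - z2 \<noteq> 0" "z2 - z3 \<noteq> 0" "z3 - z0 \<noteq> 0"
    using assms by auto
  show "(z0 + z1) / (z0 - z1) + (z1 + z2) / (z1 - z2) + (z2 + z3) / (z2 - z3) + (z3 + z0) / (z3 - z0)
      = 2 * D * (z1 * z3 - z0 * z2)"
    unfolding D_def using nz by (simp add: add_frac_eq eq_divide_eq divide_eq_eq) (simp add: algebra_simps)
  show "z0 * z1 / (z0 - z1) + z1 * z2 / (z1 - z2) + z2 * z3 / (z2 - z3) + z3 * z0 / (z3 - z0)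
      = D * (z1 * z3 * (z0 + z2) - z0 * z2 * (z1 + z3))"
    unfolding D_def using nz by (simp add: add_frac_eq eq_divide_eq divide_eq_eq) (simp add: algebra_simps)
qed

text \<open>
  The common factor of the numerator and of the denominator cancels, and the hypothesis that the
  denominator is nonzero becomes the condition that the diagonals are not parallel.
\<close>

lemma barycenter_on_diagonals:
  assumes "inscribed_quadrilateral p" and nz: "sumI p + sumK p \<noteq> 0"
  defines "z \<equiv> zvertex p"
  shows "z 0 * z 2 \<noteq> z 1 * z 3"
    and "cpx (hyperbolic_barycenter p) * (z 0 * z 2 - z 1 * z 3)
      = z 0 * z 2 * (z 1 + z 3) - z 1 * z 3 * (z 0 + z 2)"
proof -
  have dist: "z k = z l \<longleftrightarrow> k = l" for k l
    using zvertex_facts(2) assms by blast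
  have pne: "p l \<noteq> p (l + 1)" for l
    using assms(1) by (auto simp: inscribed_quadrilateral_def inj_eq)
  define D where "D = (z 0 - z 2) * (z 1 - z 3) /
    ((z 0 - z 1) * (z 1 - z 2) * (z 2 - z 3) * (z 3 - z 0))"
  have "complex_of_real (sumI p + sumK p)
      = (\<Sum>l\<in>UNIV. complex_of_real (termI (p l) (p (l + 1)) + termK (p l) (p (l + 1))))"
    by (simp add: sumI_def sumK_def sum.distrib)
  also have "\<dots> = \<i> * (\<Sum>l\<in>UNIV. (z l + z (l + 1)) / (z l - z (l + 1)))"
    unfolding barycenter_terms_cpx(1)[OF pne] z_def zvertex_def vertex_def sum_distrib_left ..
  also have "\<dots> = 2 * \<i> * D * (z 1 * z 3 - z 0 * z 2)"
    using cyclic_sums(1)[of "z 0" "z 1" "z 2" "z 3"] by (simp add: sum_over_4 wrap_4 dist D_def)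
  finally have den: "complex_of_real (sumI p + sumK p) = 2 * \<i> * D * (z 1 * z 3 - z 0 * z 2)" .
  have "Complex (sumI p - sumK p) (2 * sumJ p)
      = (\<Sum>l\<in>UNIV. Complex (termI (p l) (p (l + 1)) - termK (p l) (p (l + 1))) (termJ (p l) (p (l + 1))))"
    by (simp add: sumI_def sumJ_def sumK_def complex_eq_iff sum_subtractf)
  also have "\<dots> = 2 * \<i> * (\<Sum>l\<in>UNIV. z l * z (l + 1) / (z l - z (l + 1)))"
    unfolding barycenter_terms_cpx(2)[OF pne] z_def zvertex_def vertex_def sum_distrib_left ..
  also have "\<dots> = 2 * \<i> * D * (z 1 * z 3 * (z 0 + z 2) - z 0 * z 2 * (z 1 + z 3))"
    using cyclic_sums(2)[of "z 0" "z 1" "z 2" "z 3"] by (simp add: sum_over_4 wrap_4 dist D_def)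
  finally have num: "Complex (sumI p - sumK p) (2 * sumJ p)
    = 2 * \<i> * D * (z 1 * z 3 * (z 0 + z 2) - z 0 * z 2 * (z 1 + z 3))" .
  have D0: "D \<noteq> 0" and "z 1 * z 3 - z 0 * z 2 \<noteq> 0"
    using den nz by (metis mult_eq_0_iff of_real_eq_0_iff)+
  then show "z 0 * z 2 \<noteq> z 1 * z 3" by auto
  have "cpx (hyperbolic_barycenter p) * complex_of_real (sumI p + sumK p)
      = Complex (sumI p - sumK p) (2 * sumJ p)"
    using nz by (simp add: hyperbolic_barycenter_def cpx_def complex_eq_iff)
  then have "(2 * \<i> * D) * (cpx (hyperbolic_barycenter p) * (z 1 * z 3 - z 0 * z 2))
      = (2 * \<i> * D) * (z 1 * z 3 * (z 0 + z 2) - z 0 * z 2 * (z 1 + z 3))"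
    unfolding den num by (simp only: mult_ac)
  then have "cpx (hyperbolic_barycenter p) * (z 1 * z 3 - z 0 * z 2)
      = z 1 * z 3 * (z 0 + z 2) - z 0 * z 2 * (z 1 + z 3)"
    using D0 by simp
  then show "cpx (hyperbolic_barycenter p) * (z 0 * z 2 - z 1 * z 3)
      = z 0 * z 2 * (z 1 + z 3) - z 1 * z 3 * (z 0 + z 2)"
    by (simp add: right_diff_distrib) (simp add: diff_eq_eq add.commute)
qed

text \<open>
  The line through two points \<open>z\<close> and \<open>w\<close> of the unit circle is
  \<open>x + z * w * cnj x = z + w\<close>. So these are the equations of the two diagonals: whatever the
  quadrilateral, its hyperbolic barycenter is the point where they meet.
\<close>

lemma diagonal_meet:
  fixes z0 z1 z2 z3 S :: complex
  assumes unit: "cmod z0 = 1" "cmod z1 = 1" "cmod z2 = 1" "cmod z3 = 1"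
    and ne: "z0 * z2 \<noteq> z1 * z3"
    and S: "S * (z0 * z2 - z1 * z3) = z0 * z2 * (z1 + z3) - z1 * z3 * (z0 + z2)"
  shows "S + z0 * z2 * cnj S = z0 + z2" and "S + z1 * z3 * cnj S = z1 + z3"
proof -
  note u = unit[THEN unit_mult_cnj]
  have "cnj S * (z1 * z3 * (z0 * cnj z0) * (z2 * cnj z2) - z0 * z2 * (z1 * cnj z1) * (z3 * cnj z3))
      = z0 * z1 * z2 * z3 * cnj (S * (z0 * z2 - z1 * z3))"
    by (simp add: algebra_simps)
  also have "\<dots> = z0 * cnj z0 * (z2 * cnj z2) * (z3 * (z1 * cnj z1) + z1 * (z3 * cnj z3))
      - z1 * cnj z1 * (z3 * cnj z3) * (z2 * (z0 * cnj z0) + z0 * (z2 * cnj z2))"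
    unfolding S by (simp add: algebra_simps)
  finally have c: "cnj S * (z1 * z3 - z0 * z2) = z1 + z3 - (z0 + z2)"
    unfolding u by simp
  have ne': "z0 * z2 - z1 * z3 \<noteq> 0" using ne by simp
  have "(z0 * z2 - z1 * z3) * (S + z0 * z2 * cnj S)
      = S * (z0 * z2 - z1 * z3) - z0 * z2 * (cnj S * (z1 * z3 - z0 * z2))"
    by (simp add: algebra_simps)
  also have "\<dots> = (z0 * z2 - z1 * z3) * (z0 + z2)"
    unfolding S c by (simp add: algebra_simps)
  finally have "(z0 * z2 - z1 * z3) * (S + z0 * z2 * cnj S) = (z0 * z2 - z1 * z3) * (z0 + z2)" .
  then show "S + z0 * z2 * cnj S = z0 + z2" using ne' by simp
  have "(z0 * z2 - z1 * z3) * (S + z1 * z3 * cnj S)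
      = S * (z0 * z2 - z1 * z3) - z1 * z3 * (cnj S * (z1 * z3 - z0 * z2))"
    by (simp add: algebra_simps)
  also have "\<dots> = (z0 * z2 - z1 * z3) * (z1 + z3)"
    unfolding S c by (simp add: algebra_simps)
  finally have "(z0 * z2 - z1 * z3) * (S + z1 * z3 * cnj S) = (z0 * z2 - z1 * z3) * (z1 + z3)" .
  then show "S + z1 * z3 * cnj S = z1 + z3" using ne' by simp
qed

section \<open>The least-squares point\<close>

lemma infdist_line:
  assumes "A \<noteq> B"
  shows "infdist X (affine hull {A, B})
    = \<bar>Im (cnj (cpx B - cpx A) * (cpx X - cpx A))\<bar> / cmod (cpx B - cpx A)"
proof (rule antisym)
  define a b x where "a = cpx A" and "b = cpx B" and "x = cpx X"
  have ab: "b - a \<noteq> 0" using assms by (simp add: a_def b_def)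
  have hull: "cpx (A + u *\<^sub>R (B - A)) = a + of_real u * (b - a)" for u
    by (simp add: cpx_def a_def b_def complex_eq_iff)
  have in_hull: "A + u *\<^sub>R (B - A) \<in> affine hull {A, B}" for u
    unfolding affine_hull_2 by (intro CollectI exI[of _ "1 - u"] exI[of _ u]) (simp add: algebra_simps)
  \<comment> \<open>The parameter of the foot of the perpendicular from \<open>X\<close>.\<close>
  define u where "u = Re (cnj (b - a) * (x - a)) / (cmod (b - a))\<^sup>2"
  have "cnj (b - a) * (x - (a + of_real u * (b - a))) = cnj (b - a) * (x - a) - of_real (u * (cmod (b - a))\<^sup>2)"
    unfolding of_real_mult complex_norm_square by (simp add: algebra_simps)
  also have "\<dots> = cnj (b - a) * (x - a) - of_real (Re (cnj (b - a) * (x - a)))"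
    using ab by (simp add: u_def)
  also have "\<dots> = \<i> * of_real (Im (cnj (b - a) * (x - a)))"
    by (simp add: complex_eq_iff)
  finally have "cmod (cnj (b - a)) * cmod (x - (a + of_real u * (b - a)))
      = \<bar>Im (cnj (b - a) * (x - a))\<bar>"
    by (metis norm_mult norm_of_real norm_ii mult_1)
  then have "dist X (A + u *\<^sub>R (B - A)) = \<bar>Im (cnj (b - a) * (x - a))\<bar> / cmod (b - a)"
    using ab unfolding dist_cpx hull x_def[symmetric] complex_mod_cnj by (simp add: field_simps)
  then show "infdist X (affine hull {A, B})
      \<le> \<bar>Im (cnj (cpx B - cpx A) * (cpx X - cpx A))\<bar> / cmod (cpx B - cpx A)"
    unfolding a_def b_def x_def using infdist_le[OF in_hull, of X u] by simp
  have "\<bar>Im (cnj (b - a) * (x - a))\<bar> / cmod (b - a) \<le> dist X Y" if "Y \<in> affine hull {A, B}" for Y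
  proof -
    obtain v w where "Y = v *\<^sub>R A + w *\<^sub>R B" "v + w = 1"
      using \<open>Y \<in> _\<close> unfolding affine_hull_2 by auto
    moreover from this have "v = 1 - w" by simp
    ultimately have "Y = A + w *\<^sub>R (B - A)"
      by (simp add: algebra_simps)
    then have Y: "cpx Y = a + of_real w * (b - a)"
      by (simp only: hull)
    have "cnj (b - a) * (x - a) = cnj (b - a) * (x - cpx Y) + of_real (w * (cmod (b - a))\<^sup>2)"
      unfolding Y of_real_mult complex_norm_square by (simp add: algebra_simps)
    then have "\<bar>Im (cnj (b - a) * (x - a))\<bar> = \<bar>Im (cnj (b - a) * (x - cpx Y))\<bar>"
      by simp
    also have "\<dots> \<le> cmod (cnj (b - a) * (x - cpx Y))"
      by (rule abs_Im_le_cmod)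
    also have "\<dots> = cmod (b - a) * dist X Y"
      unfolding norm_mult complex_mod_cnj dist_cpx x_def ..
    finally show ?thesis using ab by (simp add: field_simps)
  qed
  moreover have "affine hull {A, B} \<noteq> {}" by simp
  ultimately show "\<bar>Im (cnj (cpx B - cpx A) * (cpx X - cpx A))\<bar> / cmod (cpx B - cpx A)
      \<le> infdist X (affine hull {A, B})"
    unfolding a_def b_def x_def by (simp add: infdist_notempty cINF_greatest)
qed

text \<open>
  An affine form whose zero set is the line through the points \<open>z\<close> and \<open>w\<close> of the unit circle.
  Its modulus is twice the distance to that line, since it is \<open>2 * n * (n \<bullet> x - d)\<close> for the unit
  normal \<open>n\<close>, a square root of \<open>z * w\<close>.
\<close>

definition chord_form :: "complex \<Rightarrow> complex \<Rightarrow> complex \<Rightarrow> complex" where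
  "chord_form z w x = x + z * w * cnj x - (z + w)"

lemma side_dist_chord_form:
  assumes "inscribed_quadrilateral p"
  shows "side_dist p l X = cmod (chord_form (zvertex p l) (zvertex p (l + 1)) (cpx X)) / 2"
proof -
  define z w x where "z = zvertex p l" and "w = zvertex p (l + 1)" and "x = cpx X"
  have unit: "z * cnj z = 1" "w * cnj w = 1"
    unfolding z_def w_def by (intro unit_mult_cnj zvertex_facts)+
  have ne: "w \<noteq> z"
    using assms zvertex_facts(2)[of p "l + 1" l] by (simp add: z_def w_def)
  have "cnj (w - z) * chord_form z w x
      = cnj (w - z) * x + (z * (w * cnj w) - w * (z * cnj z)) * cnj x
        - (z * cnj w + w * cnj w - z * cnj z - w * cnj z)"
    by (simp add: chord_form_def algebra_simps)
  also have "\<dots> = cnj (w - z) * (x - z) - cnj (cnj (w - z) * (x - z))"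
    unfolding unit by (simp add: algebra_simps)
  also have "\<dots> = 2 * \<i> * of_real (Im (cnj (w - z) * (x - z)))"
    unfolding complex_diff_cnj by simp
  finally have "cmod (w - z) * cmod (chord_form z w x) = 2 * \<bar>Im (cnj (w - z) * (x - z))\<bar>"
    by (metis norm_mult norm_of_real norm_ii mult_1_right complex_mod_cnj norm_numeral)
  then have "\<bar>Im (cnj (w - z) * (x - z))\<bar> / cmod (w - z) = cmod (chord_form z w x) / 2"
    using ne by (simp add: field_simps)
  moreover have "vertex p l \<noteq> vertex p (l + 1)"
    using ne by (auto simp: z_def w_def zvertex_def)
  ultimately show ?thesis
    using infdist_line[of "vertex p l" "vertex p (l + 1)" X]
    by (simp add: side_dist_def z_def w_def x_def zvertex_def)
qed

text \<open>
  The second-order Taylor expansion of the squared distance. The linear term takes the simple form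
  \<open>cnj h * chord_form z w x\<close> because the form is, up to a real factor, the unit normal, and so
  its own gradient direction.
\<close>

lemma chord_form_expand:
  assumes "cmod z = 1" "cmod w = 1"
  shows "(cmod (chord_form z w (x + h)))\<^sup>2
    = (cmod (chord_form z w x))\<^sup>2 + (cmod (h + z * w * cnj h))\<^sup>2 + 4 * Re (cnj h * chord_form z w x)"
proof -
  note u = assms[THEN unit_mult_cnj]
  define E k where "E = chord_form z w x" and "k = h + z * w * cnj h"
  have "cnj (z * w) * E = (z * cnj z) * (w * cnj w) * cnj x + cnj (z * w) * x
      - ((z * cnj z) * cnj w + cnj z * (w * cnj w))"
    by (simp add: E_def chord_form_def algebra_simps)
  also have "\<dots> = cnj E"
    unfolding u by (simp add: E_def chord_form_def algebra_simps)
  finally have sym: "cnj (z * w) * E = cnj E" .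
  have "cnj k * E = cnj h * E + h * (cnj (z * w) * E)"
    by (simp add: k_def algebra_simps)
  also have "\<dots> = cnj h * E + cnj (cnj h * E)"
    unfolding sym by simp
  finally have "Re (cnj k * E) = 2 * Re (cnj h * E)"
    by simp
  moreover have "chord_form z w (x + h) = E + k"
    by (simp add: E_def k_def chord_form_def algebra_simps)
  moreover have "(cmod (E + k))\<^sup>2 = (cmod E)\<^sup>2 + (cmod k)\<^sup>2 + 2 * Re (cnj k * E)"
    by (simp only: cmod_power2) (simp add: power2_eq_square algebra_simps)
  ultimately show ?thesis by (simp add: E_def k_def)
qed

text \<open>
  The gradient of the sum of squared distances; its vanishing is the normal equation of the
  least-squares problem.
\<close>

definition normal_form :: "(4 \<Rightarrow> complex) \<Rightarrow> complex \<Rightarrow> complex" where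
  "normal_form z x = 4 * x + (z 0 + z 2) * (z 1 + z 3) * cnj x - 2 * (z 0 + z 1 + z 2 + z 3)"

lemma sum_chord_form: "(\<Sum>l\<in>UNIV. chord_form (z l) (z (l + 1)) x) = normal_form z x"
  by (simp add: sum_over_4 wrap_4 chord_form_def normal_form_def algebra_simps)

text \<open>
  At a zero of the gradient the expansion leaves a positive definite quadratic form in the
  displacement. It is definite because two sides with a common vertex are not parallel.
\<close>

lemma least_squares_pointI:
  assumes p: "inscribed_quadrilateral p" and crit: "normal_form (zvertex p) (cpx X) = 0"
  shows "least_squares_point p = X"
proof -
  define z where "z = zvertex p"
  define F where "F Y = (\<Sum>l\<in>UNIV. (side_dist p l Y)\<^sup>2)" for Y
  define k where "k l h = h + z l * z (l + 1) * cnj h" for l h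
  have expand: "F Y = F X + (\<Sum>l\<in>UNIV. (cmod (k l (cpx Y - cpx X)))\<^sup>2) / 4" for Y
  proof -
    define h where "h = cpx Y - cpx X"
    have "4 * (side_dist p l Y)\<^sup>2 = 4 * (side_dist p l X)\<^sup>2 + (cmod (k l h))\<^sup>2
        + 4 * Re (cnj h * chord_form (z l) (z (l + 1)) (cpx X))" for l
      using chord_form_expand[of "z l" "z (l + 1)" "cpx X" h] zvertex_facts(1)
      by (simp add: side_dist_chord_form[OF p] power_divide k_def z_def h_def)
    then have "4 * F Y = 4 * F X + (\<Sum>l\<in>UNIV. (cmod (k l h))\<^sup>2)
        + 4 * Re (cnj h * (\<Sum>l\<in>UNIV. chord_form (z l) (z (l + 1)) (cpx X)))"
      unfolding F_def sum_distrib_left Re_sum sum.distrib[symmetric] by simp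
    then show ?thesis
      unfolding sum_chord_form z_def crit by (simp add: h_def z_def)
  qed
  have pos: "0 < (\<Sum>l\<in>UNIV. (cmod (k l h))\<^sup>2)" if "h \<noteq> 0" for h
  proof (rule ccontr)
    assume "\<not> ?thesis"
    then have "(\<Sum>l\<in>UNIV. (cmod (k l h))\<^sup>2) = 0"
      using sum_nonneg[of UNIV "\<lambda>l. (cmod (k l h))\<^sup>2"] by force
    then have "k l h = 0" for l
      by (subst (asm) sum_nonneg_eq_0_iff) auto
    then have "k 0 h - k 1 h = 0" by simp
    moreover have "k 0 h - k 1 h = z 1 * (z 0 - z 2) * cnj h"
      by (simp add: k_def algebra_simps)
    ultimately have "z 1 * (z 0 - z 2) * cnj h = 0" by simp
    moreover have "z 1 \<noteq> 0"
      using zvertex_facts(1)[of p 1] by (auto simp: z_def)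
    moreover have "z 0 \<noteq> z 2"
      using zvertex_facts(2)[OF p, of 0 2] by (simp add: z_def)
    ultimately show False
      using \<open>h \<noteq> 0\<close> by simp
  qed
  show ?thesis
    unfolding least_squares_point_def F_def[symmetric]
  proof (rule the_equality)
    have "F X \<le> F Y" for Y
      using expand[of Y] by (simp add: sum_nonneg)
    then show "\<forall>Y. F X \<le> F Y" by blast
  next
    fix Y
    assume "\<forall>W. F Y \<le> F W"
    then have "F Y \<le> F X" by blast
    then have "\<not> 0 < (\<Sum>l\<in>UNIV. (cmod (k l (cpx Y - cpx X)))\<^sup>2)"
      using expand[of Y] by simp
    then have "cpx Y - cpx X = 0"
      using pos by blast
    then show "Y = X" by simp
  qed
qed

lemma cmod_add_less_2:
  assumes "cmod z = 1" "cmod w = 1" "z \<noteq> w"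
  shows "cmod (z + w) < 2"
proof -
  have "(cmod (z + w))\<^sup>2 + (cmod (z - w))\<^sup>2 = 2 * (cmod z)\<^sup>2 + 2 * (cmod w)\<^sup>2"
    by (simp only: cmod_power2) (simp add: power2_eq_square algebra_simps)
  moreover have "0 < (cmod (z - w))\<^sup>2" using assms by simp
  ultimately have "(cmod (z + w))\<^sup>2 < 2 * (cmod z)\<^sup>2 + 2 * (cmod w)\<^sup>2" by linarith
  then have "(cmod (z + w))\<^sup>2 < 2\<^sup>2" using assms by simp
  then show ?thesis by (rule power_less_imp_less_base) simp
qed

text \<open>
  The equation \<open>4 * x + c * cnj x = r\<close> is solved by eliminating \<open>cnj x\<close> with its conjugate,
  which needs \<open>cmod c \<noteq> 4\<close>; here \<open>c\<close> is a product of two sums of distinct unit vectors,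
  so its modulus is less than 4.
\<close>

lemma normal_form_root:
  assumes "inscribed_quadrilateral p"
  obtains X where "normal_form (zvertex p) (cpx X) = 0"
proof -
  define z where "z = zvertex p"
  define c r where "c = (z 0 + z 2) * (z 1 + z 3)" and "r = 2 * (z 0 + z 1 + z 2 + z 3)"
  have "cmod (z 0 + z 2) < 2" "cmod (z 1 + z 3) < 2"
    using assms by (auto simp: z_def zvertex_facts intro!: cmod_add_less_2)
  then have "cmod c < 2 * 2"
    unfolding c_def norm_mult by (intro mult_strict_mono') auto
  then have "(cmod c)\<^sup>2 < 4\<^sup>2"
    by (intro power_strict_mono) auto
  then have "16 - (cmod c)\<^sup>2 \<noteq> 0" by simp
  then have nz: "complex_of_real (16 - (cmod c)\<^sup>2) \<noteq> 0"
    by (simp only: of_real_eq_0_iff not_False_eq_True)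
  define x where "x = (4 * r - c * cnj r) / of_real (16 - (cmod c)\<^sup>2)"
  have x: "x * of_real (16 - (cmod c)\<^sup>2) = 4 * r - c * cnj r"
    using nz by (simp add: x_def)
  have x': "cnj x * of_real (16 - (cmod c)\<^sup>2) = 4 * cnj r - cnj c * r"
    using arg_cong[OF x, of cnj] by simp
  have "(4 * x + c * cnj x) * of_real (16 - (cmod c)\<^sup>2) = r * (16 - c * cnj c)"
    unfolding distrib_right mult.assoc x x' by (simp add: algebra_simps)
  also have "\<dots> = r * of_real (16 - (cmod c)\<^sup>2)"
    by (simp only: of_real_diff of_real_numeral complex_norm_square)
  finally have "4 * x + c * cnj x = r"
    using nz by simp
  then have "normal_form (zvertex p) (cpx (Re x, Im x)) = 0"
    by (simp add: normal_form_def c_def r_def z_def)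
  then show thesis by (rule that)
qed

lemma least_squares_point_iff:
  assumes "inscribed_quadrilateral p"
  shows "X = least_squares_point p \<longleftrightarrow> normal_form (zvertex p) (cpx X) = 0"
  using least_squares_pointI[OF assms] normal_form_root[OF assms] by metis

text \<open>
  The sum of the two diagonal equations is \<open>2 * S + (z0 * z2 + z1 * z3) * cnj S = z0 + z1 + z2 + z3\<close>.
  Its double agrees with the normal equation except in the coefficient of \<open>cnj S\<close>, and the two
  coefficients are equal exactly when the cross ratio of the vertices is \<open>- 1\<close>.
\<close>

lemma barycenter_eq_least_squares_iff:
  assumes p: "inscribed_quadrilateral p" and nz: "sumI p + sumK p \<noteq> 0"
  defines "z \<equiv> zvertex p"
  shows "hyperbolic_barycenter p = least_squares_point p
    \<longleftrightarrow> (z 0 - z 1) * (z 2 - z 3) = (z 0 - z 3) * (z 1 - z 2) \<or> hyperbolic_barycenter p = (0, 0)"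
proof -
  define S where "S = cpx (hyperbolic_barycenter p)"
  have unit: "cmod (z l) = 1" for l
    by (simp add: z_def zvertex_facts)
  note S = diagonal_meet[OF unit unit unit unit barycenter_on_diagonals[OF p nz, folded z_def S_def]]
  have "normal_form z S = 2 * (S + z 0 * z 2 * cnj S - (z 0 + z 2)) + 2 * (S + z 1 * z 3 * cnj S - (z 1 + z 3))
      + ((z 0 - z 3) * (z 1 - z 2) - (z 0 - z 1) * (z 2 - z 3)) * cnj S"
    by (simp add: normal_form_def algebra_simps)
  also have "\<dots> = ((z 0 - z 3) * (z 1 - z 2) - (z 0 - z 1) * (z 2 - z 3)) * cnj S"
    unfolding S by simp
  finally have "normal_form z S = 0
      \<longleftrightarrow> (z 0 - z 1) * (z 2 - z 3) = (z 0 - z 3) * (z 1 - z 2) \<or> S = 0"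
    by auto
  moreover have "S = 0 \<longleftrightarrow> hyperbolic_barycenter p = (0, 0)"
    unfolding S_def cpx_origin[symmetric] cpx_eq_iff ..
  ultimately show ?thesis
    unfolding least_squares_point_iff[OF p] z_def[symmetric] S_def[symmetric] by simp
qed


section \<open>Isometries preserve the absolute cross ratio\<close>

text \<open>
  The argument of \<open>arcosh\<close> lies in the range where \<open>cosh\<close> inverts it, so the Klein distance
  determines this quotient.
\<close>

lemma cosh_klein_dist_ge_1:
  assumes "X \<in> ball 0 1" "Y \<in> ball (0 :: real \<times> real) 1"
  shows "0 < sqrt ((1 - X \<bullet> X) * (1 - Y \<bullet> Y))"
    and "1 \<le> (1 - X \<bullet> Y) / sqrt ((1 - X \<bullet> X) * (1 - Y \<bullet> Y))"
proof -
  have n: "norm X < 1" "norm Y < 1" using assms by auto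
  then have "(norm X)\<^sup>2 < 1" "(norm Y)\<^sup>2 < 1"
    by (simp_all add: power_less_one_iff)
  then have pos: "0 < 1 - X \<bullet> X" "0 < 1 - Y \<bullet> Y"
    by (simp_all add: power2_norm_eq_inner)
  then show r: "0 < sqrt ((1 - X \<bullet> X) * (1 - Y \<bullet> Y))"
    by simp
  have prod: "norm X * norm Y \<le> 1"
    using n by (intro mult_le_one) auto
  have "(1 - X \<bullet> X) * (1 - Y \<bullet> Y) = (1 - norm X * norm Y)\<^sup>2 - (norm X - norm Y)\<^sup>2"
    unfolding power2_norm_eq_inner[symmetric] by (simp add: power2_eq_square algebra_simps)
  then have "sqrt ((1 - X \<bullet> X) * (1 - Y \<bullet> Y)) \<le> 1 - norm X * norm Y"
    using prod by (intro real_le_lsqrt) auto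
  also have "\<dots> \<le> 1 - X \<bullet> Y"
    using norm_cauchy_schwarz[of X Y] by simp
  finally show "1 \<le> (1 - X \<bullet> Y) / sqrt ((1 - X \<bullet> X) * (1 - Y \<bullet> Y))"
    using r by simp
qed

lemma isometry_preserves_cosh:
  assumes f: "hyperbolic_isometry f" and X: "X \<in> ball 0 1" and Y: "Y \<in> ball 0 1"
  shows "(1 - f X \<bullet> f Y) * sqrt ((1 - X \<bullet> X) * (1 - Y \<bullet> Y))
    = (1 - X \<bullet> Y) * sqrt ((1 - f X \<bullet> f X) * (1 - f Y \<bullet> f Y))"
proof -
  have fX: "f X \<in> ball 0 1" and fY: "f Y \<in> ball 0 1"
    using f X Y unfolding hyperbolic_isometry_def by blast+
  have "klein_dist (f X) (f Y) = klein_dist X Y"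
    using f X Y unfolding hyperbolic_isometry_def by blast
  then have "cosh (klein_dist (f X) (f Y)) = cosh (klein_dist X Y)"
    by simp
  then have eq: "(1 - f X \<bullet> f Y) / sqrt ((1 - f X \<bullet> f X) * (1 - f Y \<bullet> f Y))
      = (1 - X \<bullet> Y) / sqrt ((1 - X \<bullet> X) * (1 - Y \<bullet> Y))"
    unfolding klein_dist_def cosh_arcosh_real[OF cosh_klein_dist_ge_1(2)[OF X Y]]
      cosh_arcosh_real[OF cosh_klein_dist_ge_1(2)[OF fX fY]] .
  have nz: "sqrt ((1 - f X \<bullet> f X) * (1 - f Y \<bullet> f Y)) \<noteq> 0" "sqrt ((1 - X \<bullet> X) * (1 - Y \<bullet> Y)) \<noteq> 0"
    using cosh_klein_dist_ge_1(1)[OF X Y] cosh_klein_dist_ge_1(1)[OF fX fY] by linarith+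
  show ?thesis
    by (rule frac_eq_eq[OF nz, THEN iffD1, OF eq])
qed

text \<open>
  In this combination of four distances the factors \<open>sqrt (1 - X \<bullet> X)\<close>, which vanish on the
  boundary, cancel. What remains is continuous up to the unit circle.
\<close>

lemma isometry_preserves_cross_ratio:
  assumes f: "hyperbolic_isometry f"
    and in_ball: "A \<in> ball 0 1" "B \<in> ball 0 1" "C \<in> ball 0 1" "D \<in> ball 0 1"
  shows "(1 - f A \<bullet> f B) * (1 - f C \<bullet> f D) * ((1 - A \<bullet> C) * (1 - B \<bullet> D))
    = (1 - A \<bullet> B) * (1 - C \<bullet> D) * ((1 - f A \<bullet> f C) * (1 - f B \<bullet> f D))"
proof -
  define r where "r X = sqrt (1 - X \<bullet> X)" for X :: "real \<times> real"
  have q: "(1 - f X \<bullet> f Y) * (r X * r Y) = (1 - X \<bullet> Y) * (r (f X) * r (f Y))"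
    if "X \<in> ball 0 1" "Y \<in> ball 0 1" for X Y
    using isometry_preserves_cosh[OF f that] by (simp add: r_def real_sqrt_mult)
  have pos: "r X \<noteq> 0" if "X \<in> ball 0 1" for X
    using cosh_klein_dist_ge_1(1)[OF that that] by (auto simp: r_def)
  have fb: "f X \<in> ball 0 1" if "X \<in> ball 0 1" for X
    using f that unfolding hyperbolic_isometry_def by blast
  let ?r = "r A * r B * r C * r D" and ?s = "r (f A) * r (f B) * r (f C) * r (f D)"
  have "?r \<noteq> 0" "?s \<noteq> 0"
    using pos fb in_ball by auto
  have 1: "(1 - f A \<bullet> f B) * (1 - f C \<bullet> f D) * ?r = (1 - A \<bullet> B) * (1 - C \<bullet> D) * ?s"
    using arg_cong2[OF q[of A B] q[of C D], of "(*)"] in_ball by (simp only: mult_ac simp_thms)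
  have 2: "(1 - f A \<bullet> f C) * (1 - f B \<bullet> f D) * ?r = (1 - A \<bullet> C) * (1 - B \<bullet> D) * ?s"
    using arg_cong2[OF q[of A C] q[of B D], of "(*)"] in_ball by (simp only: mult_ac simp_thms)
  have "((1 - f A \<bullet> f B) * (1 - f C \<bullet> f D) * ((1 - A \<bullet> C) * (1 - B \<bullet> D))) * (?r * ?s)
      = ((1 - f A \<bullet> f B) * (1 - f C \<bullet> f D) * ?r) * ((1 - A \<bullet> C) * (1 - B \<bullet> D) * ?s)"
    by (simp only: mult_ac)
  also have "\<dots> = ((1 - A \<bullet> B) * (1 - C \<bullet> D) * ((1 - f A \<bullet> f C) * (1 - f B \<bullet> f D))) * (?r * ?s)"
    unfolding 1 2[symmetric] by (simp only: mult_ac)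
  finally show ?thesis
    using \<open>?r \<noteq> 0\<close> \<open>?s \<noteq> 0\<close> by simp
qed

text \<open>
  The points \<open>P l\<close> are the boundary values of the isometry at the ideal points \<open>Q l\<close>; the
  invariant passes to them in the limit along the radii.
\<close>

lemma ideal_cross_ratio:
  assumes f: "hyperbolic_isometry f"
    and sphere: "\<And>l. Q l \<in> sphere 0 1"
    and lim: "\<And>l. (f \<longlongrightarrow> P l) (at (Q l) within ball 0 1)"
  shows "(1 - P i \<bullet> P j) * (1 - P k \<bullet> P l) * ((1 - Q i \<bullet> Q k) * (1 - Q j \<bullet> Q l))
    = (1 - Q i \<bullet> Q j) * (1 - Q k \<bullet> Q l) * ((1 - P i \<bullet> P k) * (1 - P j \<bullet> P l))"
proof -
  \<comment> \<open>Points of the disc that approach \<open>Q l\<close> along its radius.\<close>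
  define X where "X l n = (1 - inverse (real (Suc n))) *\<^sub>R Q l" for l n
  have "(\<lambda>n. 1 - inverse (real (Suc n))) \<longlonglongrightarrow> 1 - 0"
    by (intro tendsto_intros LIMSEQ_inverse_real_of_nat)
  then have "X l \<longlonglongrightarrow> (1 - 0) *\<^sub>R Q l" for l
    unfolding X_def by (intro tendsto_scaleR tendsto_const)
  then have X: "X l \<longlonglongrightarrow> Q l" for l
    by simp
  have ball: "X l n \<in> ball 0 1" for l n
    using sphere[of l] by (simp add: X_def field_simps)
  have "X l n \<noteq> Q l" for l n
    using ball[of l n] sphere[of l] by auto
  then have fX: "(\<lambda>n. f (X l n)) \<longlonglongrightarrow> P l" for l
    using ball by (intro filterlim_compose[OF lim]) (simp add: filterlim_at X)
  show ?thesis
  proof (rule LIMSEQ_unique)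
    show "(\<lambda>n. (1 - f (X i n) \<bullet> f (X j n)) * (1 - f (X k n) \<bullet> f (X l n))
        * ((1 - X i n \<bullet> X k n) * (1 - X j n \<bullet> X l n)))
      \<longlonglongrightarrow> (1 - P i \<bullet> P j) * (1 - P k \<bullet> P l) * ((1 - Q i \<bullet> Q k) * (1 - Q j \<bullet> Q l))"
      by (intro tendsto_intros X fX)
    show "(\<lambda>n. (1 - f (X i n) \<bullet> f (X j n)) * (1 - f (X k n) \<bullet> f (X l n))
        * ((1 - X i n \<bullet> X k n) * (1 - X j n \<bullet> X l n)))
      \<longlonglongrightarrow> (1 - Q i \<bullet> Q j) * (1 - Q k \<bullet> Q l) * ((1 - P i \<bullet> P k) * (1 - P j \<bullet> P l))"
      unfolding isometry_preserves_cross_ratio[OF f ball ball ball ball] by (intro tendsto_intros X fX)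
  qed
qed

text \<open>
  If consecutive vertices of a square have the inner product \<open>c\<close>, the right angles force the
  inner product \<open>2 * c - 1\<close> for opposite ones.
\<close>

lemma square_cross_ratio:
  assumes "inscribed_square Q"
  shows "4 * ((1 - Q 0 \<bullet> Q 1) * (1 - Q 2 \<bullet> Q 3)) = (1 - Q 0 \<bullet> Q 2) * (1 - Q 1 \<bullet> Q 3)"
    and "4 * ((1 - Q 0 \<bullet> Q 3) * (1 - Q 2 \<bullet> Q 1)) = (1 - Q 0 \<bullet> Q 2) * (1 - Q 3 \<bullet> Q 1)"
    and "0 < (1 - Q 0 \<bullet> Q 2) * (1 - Q 1 \<bullet> Q 3)"
proof -
  have sq: "Q l \<bullet> Q l = 1" for l
    using assms by (simp add: inscribed_square_def flip: power2_norm_eq_inner)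
  have d: "(dist (Q k) (Q l))\<^sup>2 = 2 - 2 * (Q k \<bullet> Q l)" for k l
    by (simp add: dist_norm power2_norm_eq_inner inner_diff sq inner_commute)
  have side: "Q l \<bullet> Q (l + 1) = Q (l + 1) \<bullet> Q (l + 2)" for l
  proof -
    have "(dist (Q l) (Q (l + 1)))\<^sup>2 = (dist (Q (l + 1)) (Q (l + 2)))\<^sup>2"
      using assms by (simp add: inscribed_square_def)
    then show ?thesis unfolding d by simp
  qed
  have diag: "Q l \<bullet> Q (l + 2) - Q l \<bullet> Q (l + 1) - Q (l + 1) \<bullet> Q (l + 2) + 1 = 0" for l
  proof -
    have "(Q l - Q (l + 1)) \<bullet> (Q (l + 2) - Q (l + 1)) = 0"
      using assms by (simp add: inscribed_square_def)
    then show ?thesis by (simp add: inner_diff sq)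
  qed
  define c where "c = Q 0 \<bullet> Q 1"
  have s: "Q 0 \<bullet> Q 1 = c" "Q 1 \<bullet> Q 2 = c" "Q 2 \<bullet> Q 3 = c" "Q 3 \<bullet> Q 0 = c"
    using side[of 0] side[of 1] side[of 2] by (simp_all add: c_def wrap_4)
  then have t: "Q 0 \<bullet> Q 2 = 2 * c - 1" "Q 1 \<bullet> Q 3 = 2 * c - 1"
    using diag[of 0] diag[of 1] by simp_all
  have "Q 0 \<noteq> Q 2"
    using assms by (auto simp: inscribed_square_def inj_eq)
  then have "0 < (dist (Q 0) (Q 2))\<^sup>2" by simp
  then have "c < 1" unfolding d t by simp
  note st = s t s(4)[unfolded inner_commute[of "Q 3" "Q 0"]] s(2)[unfolded inner_commute[of "Q 1" "Q 2"]]
    t(2)[unfolded inner_commute[of "Q 1" "Q 3"]]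
  show "4 * ((1 - Q 0 \<bullet> Q 1) * (1 - Q 2 \<bullet> Q 3)) = (1 - Q 0 \<bullet> Q 2) * (1 - Q 1 \<bullet> Q 3)"
    and "4 * ((1 - Q 0 \<bullet> Q 3) * (1 - Q 2 \<bullet> Q 1)) = (1 - Q 0 \<bullet> Q 2) * (1 - Q 3 \<bullet> Q 1)"
    unfolding st by (simp_all add: algebra_simps)
  show "0 < (1 - Q 0 \<bullet> Q 2) * (1 - Q 1 \<bullet> Q 3)"
    unfolding st using \<open>c < 1\<close> by simp
qed

lemma one_minus_inner_unit:
  assumes "cmod (cpx X) = 1" "cmod (cpx Y) = 1"
  shows "1 - X \<bullet> Y = (cmod (cpx X - cpx Y))\<^sup>2 / 2"
proof -
  have "(cmod (cpx X - cpx Y))\<^sup>2 = (cmod (cpx X))\<^sup>2 + (cmod (cpx Y))\<^sup>2 - 2 * (X \<bullet> Y)"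
    unfolding inner_cpx by (simp only: cmod_power2) (simp add: power2_eq_square algebra_simps)
  then show ?thesis using assms by simp
qed

text \<open>
  The equality case of the triangle inequality, for summands of equal length.
\<close>

lemma eq_if_cmod_half_sum:
  fixes x y :: complex
  assumes "2 * cmod x = cmod (x + y)" "2 * cmod y = cmod (x + y)"
  shows "x = y"
proof -
  have "(cmod (x - y))\<^sup>2 = 2 * (cmod x)\<^sup>2 + 2 * (cmod y)\<^sup>2 - (cmod (x + y))\<^sup>2"
    by (simp only: cmod_power2) (simp add: power2_eq_square algebra_simps)
  also have "\<dots> = ((2 * cmod x)\<^sup>2 + (2 * cmod y)\<^sup>2) / 2 - (cmod (x + y))\<^sup>2"
    by (simp add: power2_eq_square)
  also have "\<dots> = 0"
    unfolding assms by simp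
  finally show ?thesis by simp
qed

text \<open>
  Isometries only preserve the moduli of cross ratios. For the values of a square this is enough:
  both products of opposite sides have half the modulus of the product of the diagonals, which is
  their sum by Ptolemy's identity, so they are equal.
\<close>

lemma harmonicD:
  assumes "harmonic p"
  defines "z \<equiv> zvertex p"
  shows "(z 0 - z 1) * (z 2 - z 3) = (z 0 - z 3) * (z 1 - z 2)"
proof -
  obtain f Q where f: "hyperbolic_isometry f" and Q: "inscribed_square Q"
    and lim: "\<And>l. (f \<longlongrightarrow> vertex p l) (at (Q l) within ball 0 1)"
    using assms(1) unfolding harmonic_def by blast
  have sphere: "\<And>l. Q l \<in> sphere 0 1"
    using Q by (simp add: inscribed_square_def)
  have chord: "1 - vertex p k \<bullet> vertex p l = (cmod (z k - z l))\<^sup>2 / 2" for k l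
    using one_minus_inner_unit[of "vertex p k" "vertex p l"] zvertex_facts(1)
    by (simp add: z_def zvertex_def)
  note cross = ideal_cross_ratio[where Q = Q and P = "vertex p", OF f sphere lim, unfolded chord]
  have mod_eq: "2 * cmod (u * v) = cmod (s * t)"
    if "(cmod u)\<^sup>2 / 2 * ((cmod v)\<^sup>2 / 2) * b = a * ((cmod s)\<^sup>2 / 2 * ((cmod t)\<^sup>2 / 2))"
      and "4 * a = b" and "b \<noteq> 0" for u v s t :: complex and a b
  proof -
    have "a \<noteq> 0" using that by auto
    then have "4 * ((cmod u)\<^sup>2 * (cmod v)\<^sup>2) = (cmod s)\<^sup>2 * (cmod t)\<^sup>2"
      using that(1) unfolding that(2)[symmetric] by (simp add: field_simps)
    then have "(2 * cmod (u * v))\<^sup>2 = (cmod (s * t))\<^sup>2"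
      by (simp add: norm_mult power_mult_distrib)
    then show ?thesis
      by (rule power2_eq_imp_eq) auto
  qed
  have sum: "(z 0 - z 1) * (z 2 - z 3) + (z 0 - z 3) * (z 1 - z 2) = (z 0 - z 2) * (z 1 - z 3)"
    by (simp add: algebra_simps)
  have "2 * cmod ((z 0 - z 1) * (z 2 - z 3)) = cmod ((z 0 - z 2) * (z 1 - z 3))"
    using square_cross_ratio[OF Q] by (intro mod_eq[OF cross[of 0 1 2 3]]) auto
  moreover have "2 * cmod ((z 0 - z 3) * (z 2 - z 1)) = cmod ((z 0 - z 2) * (z 3 - z 1))"
    using square_cross_ratio[OF Q]
    by (intro mod_eq[OF cross[of 0 3 2 1]]) (auto simp: inner_commute)
  then have "2 * cmod ((z 0 - z 3) * (z 1 - z 2)) = cmod ((z 0 - z 2) * (z 1 - z 3))"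
    unfolding norm_mult norm_minus_commute[of "z 2" "z 1"] norm_minus_commute[of "z 3" "z 1"] .
  ultimately show ?thesis
    unfolding sum[symmetric] by (rule eq_if_cmod_half_sum)
qed

section \<open>Isometries of the Klein model with prescribed boundary values\<close>

text \<open>
  The pair \<open>(den, num)\<close> is the first row of \<open>g H g\<^sup>*\<close>, where \<open>H\<close> is the Hermitian matrix with
  rows \<open>(1, x)\<close> and \<open>(cnj x, 1)\<close>, and \<open>g\<close> has rows \<open>(a, b)\<close> and \<open>(cnj b, cnj a)\<close>.
  The disc corresponds to the positive definite \<open>H\<close> and the circle to those of rank one. Thus
  \<open>klein_map\<close> is the projective map induced by \<open>g\<close>, for either sign of \<open>det g\<close>, so that both
  orientations occur.
\<close>

definition klein_num :: "complex \<Rightarrow> complex \<Rightarrow> complex \<Rightarrow> complex" where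
  "klein_num a b x = a\<^sup>2 * x + 2 * a * b + b\<^sup>2 * cnj x"

definition klein_den :: "complex \<Rightarrow> complex \<Rightarrow> complex \<Rightarrow> real" where
  "klein_den a b x = (cmod a)\<^sup>2 + (cmod b)\<^sup>2 + 2 * Re (a * cnj b * x)"

definition klein_map :: "complex \<Rightarrow> complex \<Rightarrow> real \<times> real \<Rightarrow> real \<times> real" where
  "klein_map a b X =
    (let w = klein_num a b (cpx X) / of_real (klein_den a b (cpx X)) in (Re w, Im w))"

lemma cpx_klein_map:
  "cpx (klein_map a b X) = klein_num a b (cpx X) / of_real (klein_den a b (cpx X))"
  unfolding klein_map_def Let_def by (rule cpx_Re_Im)

lemma klein_den_complex:
  "of_real (klein_den a b x) = a * cnj a + b * cnj b + a * cnj b * x + cnj (a * cnj b * x)"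
  unfolding klein_den_def of_real_add complex_norm_square complex_add_cnj[symmetric]
  by (simp only: add.assoc)

lemma klein_den_pos:
  assumes "cmod a \<noteq> cmod b" "cmod x \<le> 1"
  shows "0 < klein_den a b x"
proof -
  have "- Re (a * cnj b * x) \<le> cmod (a * cnj b * x)"
    using abs_Re_le_cmod[of "a * cnj b * x"] by linarith
  also have "\<dots> \<le> cmod a * cmod b"
    using assms(2) by (simp add: norm_mult mult_left_le)
  finally have "(cmod a - cmod b)\<^sup>2 \<le> klein_den a b x"
    by (simp add: klein_den_def power2_diff)
  moreover have "0 < (cmod a - cmod b)\<^sup>2"
    using assms(1) by simp
  ultimately show ?thesis by linarith
qed

text \<open>
  The polarized form of \<open>det (g H g\<^sup>*) = (det g)\<^sup>2 * det H\<close>.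
\<close>

lemma klein_form_invariant:
  "klein_den a b x * klein_den a b y - Re (klein_num a b x * cnj (klein_num a b y))
    = ((cmod a)\<^sup>2 - (cmod b)\<^sup>2)\<^sup>2 * (1 - Re (x * cnj y))"
  unfolding klein_den_def klein_num_def cmod_power2
  by (simp add: power2_eq_square) (simp add: algebra_simps)

text \<open>
  The matrix with entries \<open>cnj a\<close> and \<open>- b\<close> in its first row is the adjugate of the one with entries
  \<open>a\<close> and \<open>b\<close>, so the composition is the identity up to the scalar \<open>(det g)\<^sup>2\<close>.
\<close>

lemma klein_num_inverse:
  "a\<^sup>2 * klein_num (cnj a) (- b) x + 2 * a * b * of_real (klein_den (cnj a) (- b) x)
      + b\<^sup>2 * cnj (klein_num (cnj a) (- b) x)
    = of_real (((cmod a)\<^sup>2 - (cmod b)\<^sup>2)\<^sup>2) * x"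
  unfolding klein_den_complex klein_num_def of_real_power[of "(cmod a)\<^sup>2 - (cmod b)\<^sup>2"] of_real_diff complex_norm_square
  by (simp add: power2_eq_square algebra_simps)

lemma klein_den_inverse:
  "((cmod a)\<^sup>2 + (cmod b)\<^sup>2) * klein_den (cnj a) (- b) x + 2 * Re (a * cnj b * klein_num (cnj a) (- b) x)
    = ((cmod a)\<^sup>2 - (cmod b)\<^sup>2)\<^sup>2"
  unfolding klein_den_def klein_num_def cmod_power2
  by (simp add: power2_eq_square) (simp add: algebra_simps)

lemma klein_map_invariant:
  assumes ab: "cmod a \<noteq> cmod b" and X: "norm X \<le> 1" and Y: "norm Y \<le> 1"
  shows "1 - klein_map a b X \<bullet> klein_map a b Y
    = ((cmod a)\<^sup>2 - (cmod b)\<^sup>2)\<^sup>2 * (1 - X \<bullet> Y) / (klein_den a b (cpx X) * klein_den a b (cpx Y))"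
proof -
  define dX dY where "dX = klein_den a b (cpx X)" and "dY = klein_den a b (cpx Y)"
  have pos: "0 < dX" "0 < dY"
    using X Y unfolding dX_def dY_def by (auto intro!: klein_den_pos ab simp: cmod_cpx)
  have "klein_map a b X \<bullet> klein_map a b Y
      = Re (klein_num a b (cpx X) * cnj (klein_num a b (cpx Y)) / of_real (dX * dY))"
    unfolding inner_cpx cpx_klein_map by (simp add: dX_def dY_def)
  also have "\<dots> = Re (klein_num a b (cpx X) * cnj (klein_num a b (cpx Y))) / (dX * dY)"
    by (rule Re_divide_of_real)
  finally have "1 - klein_map a b X \<bullet> klein_map a b Y
      = (dX * dY - Re (klein_num a b (cpx X) * cnj (klein_num a b (cpx Y)))) / (dX * dY)"
    using pos by (simp add: diff_divide_distrib)
  then show ?thesis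
    unfolding dX_def dY_def klein_form_invariant inner_cpx[of X Y] .
qed

lemma klein_map_in_ball:
  assumes ab: "cmod a \<noteq> cmod b" and X: "X \<in> ball 0 1"
  shows "klein_map a b X \<in> ball 0 1"
proof -
  have n: "norm X < 1" using X by simp
  have "(cmod a)\<^sup>2 - (cmod b)\<^sup>2 \<noteq> 0"
    using ab by (simp add: power2_eq_iff_nonneg)
  moreover have "0 < 1 - X \<bullet> X"
    using n by (simp add: power2_norm_eq_inner[symmetric] power_less_one_iff)
  moreover have "0 < klein_den a b (cpx X)"
    using n by (intro klein_den_pos ab) (simp add: cmod_cpx)
  ultimately have "0 < 1 - klein_map a b X \<bullet> klein_map a b X"
    unfolding klein_map_invariant[OF ab less_imp_le[OF n] less_imp_le[OF n]] by simp
  then have "(norm (klein_map a b X))\<^sup>2 < 1\<^sup>2"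
    by (simp add: power2_norm_eq_inner)
  then have "norm (klein_map a b X) < 1"
    by (rule power_less_imp_less_base) simp
  then show ?thesis by simp
qed

lemma klein_map_inverse:
  assumes ab: "cmod a \<noteq> cmod b" and X: "X \<in> ball 0 1"
  shows "klein_map a b (klein_map (cnj a) (- b) X) = X"
proof -
  define x n d D where "x = cpx X" and "n = klein_num (cnj a) (- b) x"
    and "d = klein_den (cnj a) (- b) x" and "D = ((cmod a)\<^sup>2 - (cmod b)\<^sup>2)\<^sup>2"
  have d: "0 < d"
    using ab X unfolding d_def x_def by (intro klein_den_pos) (auto simp: cmod_cpx)
  have D: "D \<noteq> 0"
    using ab by (simp add: D_def power2_eq_iff_nonneg)
  have "klein_num a b (n / of_real d) = (a\<^sup>2 * n + 2 * a * b * of_real d + b\<^sup>2 * cnj n) / of_real d"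
    using d by (simp add: klein_num_def add_divide_distrib)
  then have num: "klein_num a b (n / of_real d) = of_real D * x / of_real d"
    unfolding n_def d_def klein_num_inverse D_def .
  have "klein_den a b (n / of_real d) = (((cmod a)\<^sup>2 + (cmod b)\<^sup>2) * d + 2 * Re (a * cnj b * n)) / d"
    using d by (simp only: klein_den_def times_divide_eq_right Re_divide_of_real) (simp add: add_divide_distrib)
  then have den: "klein_den a b (n / of_real d) = D / d"
    unfolding n_def d_def klein_den_inverse D_def .
  have "cpx (klein_map a b (klein_map (cnj a) (- b) X)) = klein_num a b (n / of_real d) / of_real (klein_den a b (n / of_real d))"
    by (simp add: cpx_klein_map n_def d_def x_def)
  also have "\<dots> = x"
    unfolding num den using d D by simp
  finally show ?thesis by (simp add: x_def)
qed

lemma klein_map_isometry: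
  assumes ab: "cmod a \<noteq> cmod b"
  shows "hyperbolic_isometry (klein_map a b)"
  unfolding hyperbolic_isometry_def
proof (intro conjI ballI)
  have "X \<in> klein_map a b ` ball 0 1" if "X \<in> ball 0 1" for X
    using klein_map_inverse[OF ab that] klein_map_in_ball[of "cnj a" "- b" X] ab that
    by (metis complex_mod_cnj norm_minus_cancel imageI)
  then show "klein_map a b ` ball 0 1 = ball 0 1"
    using klein_map_in_ball[OF ab] by blast
next
  fix X Y :: "real \<times> real"
  assume X: "X \<in> ball 0 1" and Y: "Y \<in> ball 0 1"
  then have n: "norm X \<le> 1" "norm Y \<le> 1" by auto
  define D dX dY where "D = ((cmod a)\<^sup>2 - (cmod b)\<^sup>2)\<^sup>2"
    and "dX = klein_den a b (cpx X)" and "dY = klein_den a b (cpx Y)"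
  have pos: "0 < dX" "0 < dY" "0 < D"
    using n ab unfolding dX_def dY_def D_def
    by (auto intro!: klein_den_pos simp: cmod_cpx power2_eq_iff_nonneg)
  note inv = klein_map_invariant[OF ab n(1) n(1)] klein_map_invariant[OF ab n(2) n(2)]
    klein_map_invariant[OF ab n]
  have "(1 - klein_map a b X \<bullet> klein_map a b X) * (1 - klein_map a b Y \<bullet> klein_map a b Y)
      = (D / (dX * dY))\<^sup>2 * ((1 - X \<bullet> X) * (1 - Y \<bullet> Y))"
    unfolding inv D_def[symmetric] dX_def[symmetric] dY_def[symmetric]
    by (simp add: power2_eq_square mult_ac)
  then have "sqrt ((1 - klein_map a b X \<bullet> klein_map a b X) * (1 - klein_map a b Y \<bullet> klein_map a b Y))
      = (D / (dX * dY)) * sqrt ((1 - X \<bullet> X) * (1 - Y \<bullet> Y))"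
    using pos by (simp only: real_sqrt_mult real_sqrt_abs) simp
  moreover have "1 - klein_map a b X \<bullet> klein_map a b Y = (D / (dX * dY)) * (1 - X \<bullet> Y)"
    unfolding inv D_def dX_def dY_def by simp
  moreover have "D / (dX * dY) \<noteq> 0" using pos by simp
  ultimately show "klein_dist (klein_map a b X) (klein_map a b Y) = klein_dist X Y"
    unfolding klein_dist_def by (simp only: mult_divide_mult_cancel_left not_False_eq_True)
qed

text \<open>
  On the circle, \<open>H\<close> has the form \<open>v v\<^sup>*\<close> with \<open>v = (w, cnj w)\<close>, and \<open>g\<close> acts on such vectors by
  the real-linear map \<open>w \<mapsto> a * w + b * cnj w\<close>. So the boundary action is read off
  from square roots of the boundary points, up to real scalars.
\<close>

lemma klein_map_boundary:
  assumes ab: "cmod a \<noteq> cmod b" and Q: "cpx Q = w\<^sup>2" "cmod w = 1" and P: "cpx P = v\<^sup>2" "cmod v = 1"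
    and r: "a * w + b * cnj w = of_real r * v"
  shows "(klein_map a b \<longlongrightarrow> P) (at Q within ball 0 1)"
proof -
  have ww: "w * cnj w = 1" by (rule unit_mult_cnj[OF Q(2)])
  have "(a * w + b * cnj w)\<^sup>2 = a\<^sup>2 * w\<^sup>2 + 2 * a * b * (w * cnj w) + b\<^sup>2 * (cnj w)\<^sup>2"
    by (simp add: power2_eq_square algebra_simps)
  then have num: "klein_num a b (cpx Q) = of_real (r\<^sup>2) * v\<^sup>2"
    unfolding r ww by (simp add: klein_num_def Q power_mult_distrib)
  have "(a * w + b * cnj w) * cnj (a * w + b * cnj w)
      = (a * cnj a + b * cnj b) * (w * cnj w) + a * cnj b * w\<^sup>2 + cnj (a * cnj b * w\<^sup>2)"
    by (simp add: power2_eq_square algebra_simps)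
  also have "\<dots> = of_real (klein_den a b (cpx Q))"
    unfolding ww klein_den_complex Q by simp
  finally have "of_real (klein_den a b (cpx Q)) = complex_of_real (r\<^sup>2) * (v * cnj v)"
    unfolding r by (simp add: power2_eq_square mult_ac)
  then have den: "klein_den a b (cpx Q) = r\<^sup>2"
    unfolding unit_mult_cnj[OF P(2)] by (metis mult_1_right of_real_eq_iff)
  have pos: "0 < klein_den a b (cpx Q)"
    using Q by (intro klein_den_pos ab) (simp add: norm_power)
  then have nz: "complex_of_real (klein_den a b (cpx Q)) \<noteq> 0" by simp
  define g where "g X = klein_num a b (cpx X) / of_real (klein_den a b (cpx X))" for X
  have "(cpx \<longlongrightarrow> cpx Q) (at Q within ball 0 1)"
    unfolding cpx_def by (intro tendsto_Complex tendsto_fst tendsto_snd tendsto_ident_at)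
  then have "(g \<longlongrightarrow> g Q) (at Q within ball 0 1)"
    unfolding g_def klein_num_def klein_den_def
    using nz[unfolded klein_den_def] by (intro tendsto_intros)
  then have "((\<lambda>X. (Re (g X), Im (g X))) \<longlongrightarrow> (Re (g Q), Im (g Q))) (at Q within ball 0 1)"
    by (intro tendsto_intros)
  moreover have "g Q = cpx P"
    using pos unfolding g_def num den P by simp
  then have "(Re (g Q), Im (g Q)) = P"
    by (simp add: cpx_def)
  moreover have "klein_map a b = (\<lambda>X. (Re (g X), Im (g X)))"
    by (simp add: fun_eq_iff klein_map_def Let_def g_def)
  ultimately show ?thesis
    by simp
qed

definition square_vertex :: "4 \<Rightarrow> real \<times> real" where
  "square_vertex l = (if l = 0 then (1, 0) else if l = 1 then (0, 1) else if l = 2 then (-1, 0) else (0, -1))"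

lemma square_vertex_simps:
  "square_vertex 0 = (1, 0)" "square_vertex 1 = (0, 1)" "square_vertex 2 = (-1, 0)" "square_vertex 3 = (0, -1)"
  by (simp_all add: square_vertex_def)

lemma inscribed_square_vertex: "inscribed_square square_vertex"
proof -
  have "inj square_vertex"
    unfolding inj_def all_4_iff square_vertex_simps by simp
  then show ?thesis
    unfolding inscribed_square_def
    by (simp add: all_4_iff wrap_4 square_vertex_simps dist_Pair_Pair dist_real_def norm_Pair)
qed

section \<open>Construction of a harmonic quadrilateral from a square\<close>

text \<open>
  The linear relation among three vectors of the real plane, with its coefficients given by
  determinants.
\<close>

lemma plane_relation:
  fixes u v w :: complex
  shows "of_real (Im (v * cnj w)) * u + of_real (Im (u * cnj v)) * w = of_real (Im (u * cnj w)) * v"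
  by (simp add: complex_eq_iff) (simp add: algebra_simps)

lemma diff_squares_unit:
  assumes "cmod u = 1" "cmod v = 1"
  shows "u\<^sup>2 - v\<^sup>2 = 2 * \<i> * (u * v * of_real (Im (u * cnj v)))"
proof -
  have "2 * \<i> * of_real (Im (u * cnj v)) = u * cnj v - cnj (u * cnj v)"
    unfolding complex_diff_cnj by simp
  moreover have "2 * \<i> * (u * v * of_real (Im (u * cnj v))) = u * v * (2 * \<i> * of_real (Im (u * cnj v)))"
    by (simp only: mult_ac)
  ultimately have "2 * \<i> * (u * v * of_real (Im (u * cnj v))) = u * v * (u * cnj v - cnj (u * cnj v))"
    by (simp only:)
  also have "\<dots> = u\<^sup>2 * (v * cnj v) - v\<^sup>2 * (u * cnj u)"
    by (simp add: power2_eq_square algebra_simps)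
  finally show ?thesis
    unfolding assms[THEN unit_mult_cnj] by simp
qed

text \<open>
  Let \<open>u l\<close> be a square root of the vertex \<open>z l\<close>. The real-linear map of the plane that sends
  \<open>1\<close> and \<open>\<i>\<close> to multiples of \<open>u 0\<close> and \<open>u 2\<close> can be scaled such that \<open>1 + \<i>\<close> goes to a
  multiple of \<open>u 1\<close>. Then \<open>\<i> - 1\<close> goes to a multiple of \<open>u 3\<close> precisely when the cross ratio is
  \<open>- 1\<close>. The squares of the four directions are the vertices of a square, so the isometry induced
  by this map sends the square to the quadrilateral.
\<close>

lemma harmonicI:
  assumes p: "inscribed_quadrilateral p"
  defines "z \<equiv> zvertex p"
  assumes harm: "(z 0 - z 1) * (z 2 - z 3) = (z 0 - z 3) * (z 1 - z 2)"
  shows "harmonic p"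
proof -
  define u where "u l = csqrt (z l)" for l
  have u: "cmod (u l) = 1" "z l = (u l)\<^sup>2" for l
    by (simp_all add: u_def z_def zvertex_facts)
  have u0: "u l \<noteq> 0" for l using u(1)[of l] by auto
  define B where "B k l = Im (u k * cnj (u l))" for k l
  have zB: "z k - z l = 2 * \<i> * (u k * u l * of_real (B k l))" for k l
    unfolding u(2) B_def by (rule diff_squares_unit[OF u(1) u(1)])
  have B: "B k l \<noteq> 0" if "k \<noteq> l" for k l
    using zB[of k l] zvertex_facts(2)[OF p, of k l] that by (auto simp: z_def)
  have "(2 * \<i>)\<^sup>2 * (u 0 * u 1 * u 2 * u 3) * of_real (B 0 1 * B 2 3)
      = (2 * \<i>)\<^sup>2 * (u 0 * u 1 * u 2 * u 3) * of_real (B 0 3 * B 1 2)"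
    using harm unfolding zB by (simp add: power2_eq_square mult_ac)
  then have "complex_of_real (B 0 1 * B 2 3) = of_real (B 0 3 * B 1 2)"
    using u0 by simp
  then have harmB: "B 0 1 * B 2 3 = B 0 3 * B 1 2"
    by (simp only: of_real_eq_iff)

  \<comment> \<open>The images of \<open>1\<close> and \<open>\<i>\<close>, scaled such that their sum is a multiple of \<open>u 1\<close>.\<close>
  define s t where "s = of_real (B 1 2) * u 0" and "t = of_real (B 0 1) * u 2"
  have st1: "s + t = of_real (B 0 2) * u 1"
    unfolding s_def t_def B_def by (rule plane_relation)
  have st3: "t - s = of_real (B 0 1 * B 0 2 / B 0 3) * u 3"
  proof -
    have rel: "of_real (B 0 3) * u 2 - of_real (B 2 3) * u 0 = of_real (B 0 2) * u 3"
      unfolding B_def using plane_relation[of "u 2" "u 3" "u 0"] by (simp add: algebra_simps)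
    have "of_real (B 0 3) * (t - s) = of_real (B 0 1) * (of_real (B 0 3) * u 2) - of_real (B 0 3 * B 1 2) * u 0"
      by (simp add: s_def t_def algebra_simps)
    also have "\<dots> = of_real (B 0 1) * (of_real (B 0 3) * u 2 - of_real (B 2 3) * u 0)"
      unfolding harmB[symmetric] by (simp add: algebra_simps)
    finally show ?thesis
      unfolding rel using B[of 0 3] by (simp add: field_simps)
  qed
  define a b where "a = (s - \<i> * t) / 2" and "b = (s + \<i> * t) / 2"
  have image: "a * w + b * cnj w = of_real (Re w) * s + of_real (Im w) * t" for w
    by (simp add: a_def b_def complex_eq_iff) (simp add: field_simps)
  have "(cmod a)\<^sup>2 - (cmod b)\<^sup>2 = - Im (s * cnj t)"
    unfolding cmod_power2 by (simp add: a_def b_def power2_eq_square) (simp add: field_simps)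
  also have "\<dots> = - (B 1 2 * B 0 1 * B 0 2)"
    by (simp add: s_def t_def B_def algebra_simps)
  finally have "(cmod a)\<^sup>2 - (cmod b)\<^sup>2 \<noteq> 0"
    using B by simp
  then have ab: "cmod a \<noteq> cmod b" by auto
  \<comment> \<open>Unit square roots of the vertices of the square, and the real factors by which their images
    differ from the \<open>u l\<close>.\<close>
  define w where "w l = (if l = 0 then 1 else if l = 1 then Complex (sqrt (1/2)) (sqrt (1/2))
    else if l = 2 then \<i> else Complex (- sqrt (1/2)) (sqrt (1/2)))" for l :: 4
  define r where "r l = (if l = 0 then B 1 2 else if l = 1 then sqrt (1/2) * B 0 2
    else if l = 2 then B 0 1 else sqrt (1/2) * (B 0 1 * B 0 2 / B 0 3))" for l :: 4
  have "\<forall>l. cpx (square_vertex l) = (w l)\<^sup>2 \<and> cmod (w l) = 1 \<and> a * w l + b * cnj (w l) = of_real (r l) * u l"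
    unfolding all_4_iff
  proof (intro conjI)
    show "a * w 1 + b * cnj (w 1) = of_real (r 1) * u 1"
    proof -
      have "a * w 1 + b * cnj (w 1) = of_real (sqrt (1/2)) * (s + t)"
        unfolding image by (simp add: w_def algebra_simps)
      then show ?thesis unfolding st1 by (simp add: r_def)
    qed
    show "a * w 3 + b * cnj (w 3) = of_real (r 3) * u 3"
    proof -
      have "a * w 3 + b * cnj (w 3) = of_real (sqrt (1/2)) * (t - s)"
        unfolding image by (simp add: w_def algebra_simps)
      then show ?thesis unfolding st3 by (simp add: r_def)
    qed
  qed (unfold image, simp_all add: w_def r_def s_def t_def square_vertex_simps cpx_def complex_eq_iff
        power2_eq_square cmod_def real_sqrt_divide)
  then have "(klein_map a b \<longlongrightarrow> vertex p l) (at (square_vertex l) within ball 0 1)" for l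
    using klein_map_boundary[OF ab, of "square_vertex l" "w l" "vertex p l" "u l" "r l"] u[of l]
    by (simp add: z_def zvertex_def)
  then show ?thesis
    unfolding harmonic_def using klein_map_isometry[OF ab] inscribed_square_vertex by blast
qed


section \<open>The characterization of harmonic quadrilaterals\<close>

theorem theorem7p6:
  fixes p :: "4 \<Rightarrow> rp1"
  assumes "inscribed_quadrilateral p"
    and "sumI p + sumK p \<noteq> 0"
  shows "hyperbolic_barycenter p = least_squares_point p \<longleftrightarrow>
    harmonic p \<or> hyperbolic_barycenter p = (0, 0)"
  unfolding barycenter_eq_least_squares_iff[OF assms]
  using harmonicD harmonicI[OF assms(1)] by blast

end
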